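(* Let $X$ be a Banach space and consider $u'(t)=F(u(t))$, $u(t_0)=u_0$. Suppose that this problem possesses a sufficiently smooth solution $u:[0,T]\to X$ with derivatives in $X$, that $F:X\to X$ is sufficiently often Fréchet differentiable in a strip along the exact solution, and that all occurring derivatives are bounded. Consider an explicit 2-stage exponential Rosenbrock scheme with node $c_2$ and coefficient $b_2$ (as defined in the context), where $b_2$ can be expanded as $$b_2(h\tilde J_n)=\sum_{k\ge 0}\beta_k (h\tilde J_n)^k=\beta_0 I+\beta_1 h\tilde J_n+\mathcal{O}(h^2).$$ Then the scheme has order of consistency five, i.e. the local error satisfies $\tilde e_{n+1}=\mathcal{O}(h^5)$, if the following order conditions are fulfilled: $$\frac{\beta_0c_2^2}{2!}=\frac1{3!},\qquad \frac{\beta_0c_2^3}{3!}=\frac1{4!},\qquad \frac{\beta_1c_2^2}{2!}=\frac1{4!},$$ which is equivalent to $$c_2=\frac34,\qquad \beta_0=\frac{16}{27},\qquad \beta_1=\frac{4}{27}.$$ Here the remainder term of $\tilde e_{n+1}$ hidden behind the Landau notation is bounded by $Ch^5$ with a constant $C$ that depends on $\|\tilde J_n\|$.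
   Context: Functions $\varphi_k$: $\varphi_0(z)=e^z$ and $\varphi_k(z)=\int_0^1 e^{(1-\theta)z}\frac{\theta^{k-1}}{(k-1)!}\,d\theta$ for $k\ge1$; they are entire and are applied to operators. Explicit 2-stage exponential Rosenbrock scheme with node $c_2$ and coefficient $b_2$, step size $h>0$, $t_n=t_0+nh$, $u_n\approx u(t_n)$: with $J_n=\frac{\partial F}{\partial u}(u_n)$ and $g_n(u)=F(u)-J_nu$, $$U_{n2}=u_n+c_2h\varphi_1(c_2hJ_n)F(u_n),\qquad u_{n+1}=u_n+h\varphi_1(hJ_n)F(u_n)+h\,b_2(hJ_n)\big(g_n(U_{n2})-g_n(u_n)\big).$$ Local error: let $\tilde u_n=u(t_n)$ be the exact solution, $\tilde J_n=\frac{\partial F}{\partial u}(\tilde u_n)$, $\tilde g_n(u)=F(u)-\tilde J_nu$. One step of the scheme starting from the exact value $\tilde u_n$ gives $$\bar U_{n2}=\tilde u_n+c_2h\varphi_1(c_2h\tilde J_n)F(\tilde u_n),\qquad \bar u_{n+1}=\tilde u_n+h\varphi_1(h\tilde J_n)F(\tilde u_n)+h\,b_2(h\tilde J_n)\big(\tilde g_n(\bar U_{n2})-\tilde g_n(\tilde u_n)\big),$$ and the local error is $\tilde e_{n+1}=\bar u_{n+1}-\tilde u_{n+1}=\bar u_{n+1}-u(t_{n+1})$. *)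

theory Defs
  imports "HOL-Analysis.Analysis"
begin

text \<open>Functions of a bounded operator. The type of bounded operators is not an instance of the
  algebra classes, so powers and the exponential series are spelled out.\<close>

definition op_power :: "('a::real_normed_vector \<Rightarrow>\<^sub>L 'a) \<Rightarrow> nat \<Rightarrow> ('a \<Rightarrow>\<^sub>L 'a)" where
  "op_power A k = ((\<lambda>B. A o\<^sub>L B) ^^ k) id_blinfun"

definition op_exp :: "('a::banach \<Rightarrow>\<^sub>L 'a) \<Rightarrow> ('a \<Rightarrow>\<^sub>L 'a)" where
  "op_exp A = (\<Sum>k. (1 / fact k) *\<^sub>R op_power A k)"

definition op_phi :: "nat \<Rightarrow> ('a::banach \<Rightarrow>\<^sub>L 'a) \<Rightarrow> ('a \<Rightarrow>\<^sub>L 'a)" where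
  "op_phi k A =
     (if k = 0 then op_exp A
      else integral {0..1} (\<lambda>\<theta>. (\<theta> ^ (k - 1) / fact (k - 1)) *\<^sub>R op_exp ((1 - \<theta>) *\<^sub>R A)))"

text \<open>\<open>b\<close> is given near the zero operator by the power series with coefficients \<open>\<beta>\<close>, the series
  converging in operator norm. For bounded \<open>J\<close> this covers \<open>h J\<close> for all small \<open>h\<close>, and it entails
  that \<open>b (h J)\<close> equals \<open>\<beta> 0\<close> times the identity plus \<open>\<beta> 1 * h\<close> times \<open>J\<close>, up to \<open>O(h^2)\<close>.\<close>

definition has_op_expansion ::
    "(('a::real_normed_vector \<Rightarrow>\<^sub>L 'a) \<Rightarrow> ('a \<Rightarrow>\<^sub>L 'a)) \<Rightarrow> (nat \<Rightarrow> real) \<Rightarrow> bool" where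
  "has_op_expansion b \<beta> \<longleftrightarrow>
     (\<exists>r>0. \<forall>A. norm A < r \<longrightarrow> (\<lambda>k. \<beta> k *\<^sub>R op_power A k) sums b A)"

text \<open>The Frechet derivative as an operator-valued map, so that it can be iterated:
  \<open>fderiv (fderiv f)\<close> is the second derivative, and so on. It is meaningful at points of
  differentiability only.\<close>

definition fderiv ::
    "('a::real_normed_vector \<Rightarrow> 'b::real_normed_vector) \<Rightarrow> 'a \<Rightarrow> ('a \<Rightarrow>\<^sub>L 'b)" where
  "fderiv f x = Blinfun (frechet_derivative f (at x))"

text \<open>The \<open>j\<close>-th derivative of a curve on \<open>[0,T]\<close>, one-sided at the endpoints.\<close>

definition tderiv :: "real \<Rightarrow> nat \<Rightarrow> (real \<Rightarrow> 'a::real_normed_vector) \<Rightarrow> real \<Rightarrow> 'a" where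
  "tderiv T j u = ((\<lambda>v t. vector_derivative v (at t within {0..T})) ^^ j) u"

definition strip :: "(real \<Rightarrow> 'a::real_normed_vector) \<Rightarrow> real \<Rightarrow> real \<Rightarrow> 'a set" where
  "strip u T \<delta> = {x. \<exists>t\<in>{0..T}. norm (x - u t) < \<delta>}"

definition solves_ivp ::
    "('a::real_normed_vector \<Rightarrow> 'a) \<Rightarrow> real \<Rightarrow> 'a \<Rightarrow> real \<Rightarrow> (real \<Rightarrow> 'a) \<Rightarrow> bool" where
  "solves_ivp F t0 u0 T u \<longleftrightarrow>
     0 < T \<and> t0 \<in> {0..T} \<and> u t0 = u0 \<and>
     (\<forall>t\<in>{0..T}. (u has_vector_derivative F (u t)) (at t within {0..T}))"

text \<open>Five bounded derivatives of the solution and four bounded Frechet derivatives of the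
  vector field are what fifth order local errors require. The number \<open>M\<close> does not bound the first
  derivative of \<open>F\<close>, which is only required to be bounded: the dependence of the error constant on
  the norm of the Jacobian is tracked separately.\<close>

definition smooth_solution :: "real \<Rightarrow> real \<Rightarrow> (real \<Rightarrow> 'a::real_normed_vector) \<Rightarrow> bool" where
  "smooth_solution M T u \<longleftrightarrow>
     (\<forall>j<5. \<forall>t\<in>{0..T}. tderiv T j u differentiable (at t within {0..T})) \<and>
     (\<forall>j\<in>{1..5}. \<forall>t\<in>{0..T}. norm (tderiv T j u t) \<le> M)"

definition smooth_field :: "real \<Rightarrow> 'a::real_normed_vector set \<Rightarrow> ('a \<Rightarrow> 'a) \<Rightarrow> bool" where
  "smooth_field M S F \<longleftrightarrow>
     (\<forall>x\<in>S. F differentiable (at x) \<and>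
            fderiv F differentiable (at x) \<and>
            fderiv (fderiv F) differentiable (at x) \<and>
            fderiv (fderiv (fderiv F)) differentiable (at x)) \<and>
     bounded (fderiv F ` S) \<and>
     (\<forall>x\<in>S. norm (fderiv (fderiv F) x) \<le> M \<and>
            norm (fderiv (fderiv (fderiv F)) x) \<le> M \<and>
            norm (fderiv (fderiv (fderiv (fderiv F))) x) \<le> M)"

text \<open>In the scheme \<open>v\<close> is the value the step starts from, and the Jacobian is taken there.\<close>

definition ros_g :: "('a::real_normed_vector \<Rightarrow> 'a) \<Rightarrow> 'a \<Rightarrow> 'a \<Rightarrow> 'a" where
  "ros_g F v w = F w - blinfun_apply (fderiv F v) w"

definition ros_stage :: "('a::banach \<Rightarrow> 'a) \<Rightarrow> real \<Rightarrow> real \<Rightarrow> 'a \<Rightarrow> 'a" where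
  "ros_stage F c2 h v =
     v + (c2 * h) *\<^sub>R blinfun_apply (op_phi 1 ((c2 * h) *\<^sub>R fderiv F v)) (F v)"

definition ros_step ::
    "('a::banach \<Rightarrow> 'a) \<Rightarrow> real \<Rightarrow> (('a \<Rightarrow>\<^sub>L 'a) \<Rightarrow> ('a \<Rightarrow>\<^sub>L 'a)) \<Rightarrow> real \<Rightarrow> 'a \<Rightarrow> 'a" where
  "ros_step F c2 b2 h v =
     v + h *\<^sub>R blinfun_apply (op_phi 1 (h *\<^sub>R fderiv F v)) (F v)
       + h *\<^sub>R blinfun_apply (b2 (h *\<^sub>R fderiv F v)) (ros_g F v (ros_stage F c2 h v) - ros_g F v v)"

definition grid :: "real \<Rightarrow> real \<Rightarrow> nat \<Rightarrow> real" where
  "grid t0 h n = t0 + real n * h"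

text \<open>The error at the grid point with index \<open>Suc n\<close> of one step from the exact value at index \<open>n\<close>.\<close>

definition local_error ::
    "('a::banach \<Rightarrow> 'a) \<Rightarrow> real \<Rightarrow> (('a \<Rightarrow>\<^sub>L 'a) \<Rightarrow> ('a \<Rightarrow>\<^sub>L 'a)) \<Rightarrow> (real \<Rightarrow> 'a) \<Rightarrow> real \<Rightarrow> real \<Rightarrow> nat \<Rightarrow> 'a" where
  "local_error F c2 b2 u t0 h n =
     ros_step F c2 b2 h (u (grid t0 h n)) - u (grid t0 h (Suc n))"

definition order_conditions :: "real \<Rightarrow> (nat \<Rightarrow> real) \<Rightarrow> bool" where
  "order_conditions c2 \<beta> \<longleftrightarrow>
     \<beta> 0 * c2 ^ 2 / fact 2 = 1 / fact 3 \<and>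
     \<beta> 0 * c2 ^ 3 / fact 3 = 1 / fact 4 \<and>
     \<beta> 1 * c2 ^ 2 / fact 2 = 1 / fact 4"

end

theory Submission
  imports Defs
begin

text \<open>
  Let \<open>v\<close> be the exact value at the start of the step, \<open>f = F v\<close>, and let \<open>J\<close> be the Jacobian at \<open>v\<close>.
  Write \<open>F (v + y) = f + J y + Q y\<close>. The increment \<open>Q\<close> of the nonlinear part has no linear term, and
  Taylor's formula gives \<open>Q y = H y y / 2 + T y y y / 6 + O(|y|^4)\<close>, where \<open>H\<close>
  and \<open>T\<close> are the second and third derivatives of \<open>F\<close> at \<open>v\<close>.

  The point of the scheme is that the exact solution \<open>y(s) = u(t + s) - v\<close> and the stage
  \<open>y(s) = s \<phi>\<^sub>1(s J) f\<close> have the same expansion \<open>s f + (s^2/2) J f + O(s^3)\<close>. Since \<open>Q\<close> starts with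
  a quadratic term, these two coefficients already determine \<open>Q (y s)\<close> up to \<open>O(s^4)\<close>: along either curve
  \<open>Q (y s) = (s^2/2) a + (s^3/6) b + O(s^4)\<close> with the same vectors \<open>a\<close> and \<open>b\<close>, called \<open>incr2\<close> and
  \<open>incr3\<close> below (\<open>increment_of_two_jet\<close>).

  Integrating \<open>y' = f + J y + Q y\<close> repeatedly, each pass gaining one power of \<open>s\<close>, shows that
  \<open>u(t + h) - v\<close> equals
  \<open>h f + (h^2/2) J f + (h^3/6) (J^2 f + a) + (h^4/24) (J^3 f + J a + b)\<close> up to \<open>O(h^5)\<close>
  (\<open>flow_expansion\<close>). In the numerical step, the term \<open>h \<phi>\<^sub>1(h J) f\<close> supplies the summands with powers
  of \<open>J\<close> applied to \<open>f\<close>, and the correction \<open>h b\<^sub>2(h J) Q(y(c\<^sub>2 h))\<close> supplies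
  \<open>h^3 (\<beta>\<^sub>0 c\<^sub>2^2/2) a + h^4 (\<beta>\<^sub>0 c\<^sub>2^3/6) b + h^4 (\<beta>\<^sub>1 c\<^sub>2^2/2) J a\<close>. The three order conditions say
  precisely that these coefficients are \<open>1/6\<close>, \<open>1/24\<close> and \<open>1/24\<close> (\<open>correction_expansion\<close>).

  Apart from the remainder constants of the power series of \<open>\<phi>\<^sub>1\<close> and \<open>b\<^sub>2\<close>, only two numbers enter the
  error constants: a bound \<open>m\<close> for \<open>F\<close> along the solution and for the derivatives of \<open>F\<close> of order two
  to four, and a bound \<open>l\<close> for \<open>J\<close> at the single point \<open>v\<close>. This makes the constant of the local error
  uniform over all problems with the same bounds.
\<close>

section \<open>Bounds from derivatives\<close>

text \<open>This replaces integration of the bound \<open>K s^k\<close>. The mean value inequality on \<open>[0, s]\<close> loses the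
  factor \<open>1 / (k + 1)\<close>, but only the power of \<open>s\<close> matters below.\<close>

lemma norm_le_power_Suc:
  fixes e :: "real \<Rightarrow> 'b::real_normed_vector"
  assumes der: "\<And>s. s \<in> {0..h} \<Longrightarrow> (e has_vector_derivative e' s) (at s within {0..h})"
    and zero: "e 0 = 0"
    and bound: "\<And>s. s \<in> {0..h} \<Longrightarrow> norm (e' s) \<le> K * s ^ k"
    and s: "s \<in> {0..h}"
  shows "norm (e s) \<le> K * s ^ Suc k"
proof (cases "s = 0")
  case True
  then show ?thesis using zero by simp
next
  case False
  then have "0 < s" using s by auto
  have "0 \<le> K * s ^ k" using bound[OF s] norm_ge_zero order_trans by blast
  then have K: "0 \<le> K" using zero_less_power[OF \<open>0 < s\<close>, of k] by (auto simp: zero_le_mult_iff)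
  have "norm (e s - e 0) \<le> (K * s ^ k) * norm (s - 0)"
  proof (rule differentiable_bound[where S = "{0..s}" and f' = "\<lambda>t x. x *\<^sub>R e' t"])
    fix t assume t: "t \<in> {0..s}"
    then have t': "t \<in> {0..h}" using s by auto
    show "(e has_derivative (\<lambda>x. x *\<^sub>R e' t)) (at t within {0..s})"
      using has_vector_derivative_within_subset[OF der[OF t'], of "{0..s}"] s
      by (simp add: has_vector_derivative_def)
    have "norm (e' t) \<le> K * t ^ k" by (rule bound[OF t'])
    also have "\<dots> \<le> K * s ^ k" using t K by (intro mult_left_mono power_mono) auto
    finally have "norm (e' t) \<le> K * s ^ k" .
    then show "onorm (\<lambda>x. x *\<^sub>R e' t) \<le> K * s ^ k"
      using K \<open>0 < s\<close>
      by (intro onorm_bound) (auto simp: mult.commute[of _ "norm (e' t)"] intro: mult_right_mono)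
  qed (use \<open>0 < s\<close> in auto)
  then show ?thesis using zero \<open>0 < s\<close> by (simp add: mult_ac)
qed

lemma fderiv_has_derivative:
  assumes "f differentiable (at x)"
  shows "(f has_derivative blinfun_apply (fderiv f x)) (at x)"
proof -
  have "(f has_derivative frechet_derivative f (at x)) (at x)"
    using assms frechet_derivative_works by blast
  then show ?thesis
    unfolding fderiv_def by (simp add: bounded_linear_Blinfun_apply has_derivative_bounded_linear)
qed

lemma fderiv_along_segment:
  assumes "G differentiable (at (v + s *\<^sub>R y))"
  shows "((\<lambda>s. G (v + s *\<^sub>R y)) has_vector_derivative blinfun_apply (fderiv G (v + s *\<^sub>R y)) y) (at s within I)"
proof -
  have "((\<lambda>s. v + s *\<^sub>R y) has_derivative (\<lambda>d. d *\<^sub>R y)) (at s within I)"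
    by (auto intro!: derivative_eq_intros)
  from has_derivative_compose[OF this fderiv_has_derivative[OF assms]]
  show ?thesis by (simp add: has_vector_derivative_def blinfun.bilinear_simps)
qed

text \<open>Along the segment \<open>v + s y\<close> the derivatives of \<open>F\<close> become derivatives of curves in one real variable,
  and the bound on the fourth one is integrated four times. The bounded linear functions in the
  statement are iterated derivatives, so the earlier argument is the later direction of
  differentiation; on the diagonal the order of the arguments is immaterial.\<close>

lemma Taylor_third_order_fderiv:
  fixes F :: "'a::real_normed_vector \<Rightarrow> 'b::real_normed_vector"
  assumes d: "\<And>x. x \<in> ball v \<delta> \<Longrightarrow> F differentiable (at x)"
      "\<And>x. x \<in> ball v \<delta> \<Longrightarrow> fderiv F differentiable (at x)"
      "\<And>x. x \<in> ball v \<delta> \<Longrightarrow> fderiv (fderiv F) differentiable (at x)"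
      "\<And>x. x \<in> ball v \<delta> \<Longrightarrow> fderiv (fderiv (fderiv F)) differentiable (at x)"
    and M: "\<And>x. x \<in> ball v \<delta> \<Longrightarrow> norm (fderiv (fderiv (fderiv (fderiv F))) x) \<le> M"
    and y: "norm y < \<delta>"
  shows "norm (F (v + y) - F v - fderiv F v y - (1/2) *\<^sub>R fderiv (fderiv F) v y y
            - (1/6) *\<^sub>R fderiv (fderiv (fderiv F)) v y y y) \<le> M * norm y ^ 4"
proof -
  define p0 where "p0 = (\<lambda>s. F (v + s *\<^sub>R y))"
  define p1 where "p1 = (\<lambda>s. fderiv F (v + s *\<^sub>R y) y)"
  define p2 where "p2 = (\<lambda>s. fderiv (fderiv F) (v + s *\<^sub>R y) y y)"
  define p3 where "p3 = (\<lambda>s. fderiv (fderiv (fderiv F)) (v + s *\<^sub>R y) y y y)"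
  define p4 where "p4 = (\<lambda>s. fderiv (fderiv (fderiv (fderiv F))) (v + s *\<^sub>R y) y y y y)"
  have in_ball: "v + s *\<^sub>R y \<in> ball v \<delta>" if "s \<in> {0..1}" for s
  proof -
    have "\<bar>s\<bar> * norm y \<le> 1 * norm y" using that by (intro mult_right_mono) auto
    then show ?thesis using y by (simp add: dist_norm)
  qed
  have app: "((\<lambda>s. A s y) has_vector_derivative A' y) (at s within I)"
    if "(A has_vector_derivative A') (at s within I)" for A :: "real \<Rightarrow> 'a \<Rightarrow>\<^sub>L 'c::real_normed_vector" and A' s I
    by (rule bounded_linear.has_vector_derivative[OF blinfun.bounded_linear_left that])
  have D0: "(p0 has_vector_derivative p1 s) (at s within {0..1})" if "s \<in> {0..1}" for s
    unfolding p0_def p1_def by (rule fderiv_along_segment[OF d(1)[OF in_ball[OF that]]])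
  have D1: "(p1 has_vector_derivative p2 s) (at s within {0..1})" if "s \<in> {0..1}" for s
    unfolding p1_def p2_def by (rule app fderiv_along_segment d(2) in_ball that)+
  have D2: "(p2 has_vector_derivative p3 s) (at s within {0..1})" if "s \<in> {0..1}" for s
    unfolding p2_def p3_def by (rule app fderiv_along_segment d(3) in_ball that)+
  have D3: "(p3 has_vector_derivative p4 s) (at s within {0..1})" if "s \<in> {0..1}" for s
    unfolding p3_def p4_def by (rule app fderiv_along_segment d(4) in_ball that)+
  let ?N = "M * norm y ^ 4"
  have B4: "norm (p4 s) \<le> ?N * s ^ 0" if "s \<in> {0..1}" for s
  proof -
    let ?D = "fderiv (fderiv (fderiv (fderiv F))) (v + s *\<^sub>R y)"
    have "norm (p4 s) \<le> norm (?D y y y) * norm y" unfolding p4_def by (rule norm_blinfun)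
    also have "\<dots> \<le> (norm (?D y y) * norm y) * norm y"
      by (intro mult_right_mono norm_blinfun norm_ge_zero)
    also have "\<dots> \<le> ((norm (?D y) * norm y) * norm y) * norm y"
      by (intro mult_right_mono norm_blinfun norm_ge_zero)
    also have "\<dots> \<le> (((norm ?D * norm y) * norm y) * norm y) * norm y"
      by (intro mult_right_mono norm_blinfun norm_ge_zero)
    also have "\<dots> \<le> (((M * norm y) * norm y) * norm y) * norm y"
      by (intro mult_right_mono norm_ge_zero M in_ball that)
    finally show ?thesis by (simp add: eval_nat_numeral mult_ac)
  qed
  have B3: "norm (p3 s - p3 0) \<le> ?N * s ^ Suc 0" if "s \<in> {0..1}" for s
    by (rule norm_le_power_Suc[where e' = p4, OF _ _ B4 that])
      (auto intro!: derivative_eq_intros D3)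
  have B2: "norm (p2 s - p2 0 - s *\<^sub>R p3 0) \<le> ?N * s ^ Suc (Suc 0)" if "s \<in> {0..1}" for s
    by (rule norm_le_power_Suc[where e' = "\<lambda>s. p3 s - p3 0", OF _ _ B3 that])
      (auto intro!: derivative_eq_intros D2)
  have B1: "norm (p1 s - p1 0 - s *\<^sub>R p2 0 - (s^2/2) *\<^sub>R p3 0) \<le> ?N * s ^ Suc (Suc (Suc 0))"
    if "s \<in> {0..1}" for s
    by (rule norm_le_power_Suc[where e' = "\<lambda>s. p2 s - p2 0 - s *\<^sub>R p3 0", OF _ _ B2 that])
      (auto intro!: derivative_eq_intros D1)
  have B0: "norm (p0 s - p0 0 - s *\<^sub>R p1 0 - (s^2/2) *\<^sub>R p2 0 - (s^3/6) *\<^sub>R p3 0)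
      \<le> ?N * s ^ Suc (Suc (Suc (Suc 0)))" if "s \<in> {0..1}" for s
    by (rule norm_le_power_Suc[where e' = "\<lambda>s. p1 s - p1 0 - s *\<^sub>R p2 0 - (s^2/2) *\<^sub>R p3 0", OF _ _ B1 that])
      (auto intro!: derivative_eq_intros D0)
  show ?thesis using B0[of 1] by (simp add: p0_def p1_def p2_def p3_def)
qed

section \<open>Power series of bounded operators\<close>

lemma op_power_0 [simp]: "op_power A 0 = id_blinfun"
  by (simp add: op_power_def)

lemma op_power_Suc [simp]: "op_power A (Suc k) = A o\<^sub>L op_power A k"
  by (simp add: op_power_def)

text \<open>The norm of the identity is kept as a factor: it is \<open>0\<close> on the trivial space and \<open>1\<close> otherwise, and
  this form serves both.\<close>

lemma norm_op_power_le: "norm (op_power A k) \<le> norm A ^ k * norm (id_blinfun :: 'a \<Rightarrow>\<^sub>L 'a)"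
  for A :: "'a::real_normed_vector \<Rightarrow>\<^sub>L 'a"
proof (induction k)
  case (Suc k)
  have "norm (op_power A (Suc k)) \<le> norm A * norm (op_power A k)"
    by (simp add: norm_blinfun_compose)
  also have "\<dots> \<le> norm A * (norm A ^ k * norm (id_blinfun :: 'a \<Rightarrow>\<^sub>L 'a))"
    by (intro mult_left_mono Suc norm_ge_zero)
  finally show ?case by (simp add: mult_ac)
qed simp

lemma norm_op_power_le_power: "norm (op_power A k) \<le> norm A ^ k"
  for A :: "'a::real_normed_vector \<Rightarrow>\<^sub>L 'a"
  using norm_op_power_le[of A k] mult_left_mono[OF norm_blinfun_id_le[where 'a = 'a], of "norm A ^ k"]
  by simp

lemma op_power_scaleR: "op_power (c *\<^sub>R A) k = c ^ k *\<^sub>R op_power A k"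
  by (induction k) (auto intro!: blinfun_eqI simp: blinfun.bilinear_simps)

lemma op_power_id: "op_power id_blinfun k = id_blinfun"
  by (induction k) (auto intro!: blinfun_eqI)

text \<open>Convergence at the multiple \<open>(r/2) I\<close> of the identity bounds \<open>\<bar>\<beta> k\<bar> (r/2)^k |I|\<close> uniformly in \<open>k\<close>. For
  operators of norm at most \<open>r/4\<close> the tail of the series is then dominated by a geometric series of
  ratio \<open>1/2\<close>. Keeping the factor \<open>|I|\<close> on both sides avoids a separate treatment of the trivial
  space, where the series says nothing about the coefficients.\<close>

lemma op_expansion_remainder:
  fixes b :: "('a::banach \<Rightarrow>\<^sub>L 'a) \<Rightarrow> ('a \<Rightarrow>\<^sub>L 'a)"
  assumes "has_op_expansion b \<beta>"
  obtains K \<rho> where "0 \<le> K" "0 < \<rho>"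
    "\<And>A. norm A \<le> \<rho> \<Longrightarrow> norm (b A - (\<Sum>k<N. \<beta> k *\<^sub>R op_power A k)) \<le> K * norm A ^ N"
proof -
  obtain r where r: "0 < r" and
    sums: "\<And>A. norm A < r \<Longrightarrow> (\<lambda>k. \<beta> k *\<^sub>R op_power A k) sums b A"
    using assms unfolding has_op_expansion_def by auto
  define I where "I = (id_blinfun :: 'a \<Rightarrow>\<^sub>L 'a)"
  have I: "norm I \<le> 1" unfolding I_def by (rule norm_blinfun_id_le)
  have "norm ((r/2) *\<^sub>R I) < r"
    using r I mult_left_mono[OF I, of "r/2"] by simp
  from sums_summable[OF sums[OF this]]
  have "(\<lambda>k. \<beta> k *\<^sub>R op_power ((r/2) *\<^sub>R I) k) \<longlonglongrightarrow> 0" by (rule summable_LIMSEQ_zero)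
  then have "Bseq (\<lambda>k. \<beta> k *\<^sub>R op_power ((r/2) *\<^sub>R I) k)"
    by (intro convergent_imp_Bseq) (auto simp: convergent_def)
  then obtain B where B: "0 < B" "\<And>k. norm (\<beta> k *\<^sub>R op_power ((r/2) *\<^sub>R I) k) \<le> B"
    by (auto simp: Bseq_def)
  have coeff: "\<bar>\<beta> k\<bar> * (r/2) ^ k * norm I \<le> B" for k
    using B(2)[of k] r by (simp add: I_def op_power_scaleR op_power_id power_divide abs_mult power_abs mult_ac)
  show thesis
  proof
    show "0 \<le> 2 * B * (2/r) ^ N" "0 < r/4" using B r by auto
  next
    fix A :: "'a \<Rightarrow>\<^sub>L 'a"
    assume A: "norm A \<le> r/4"
    define q where "q = norm A / (r/2)"
    have q: "0 \<le> q" "q \<le> 1/2" using A r by (auto simp: q_def field_simps)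
    have summand: "norm (\<beta> (k + N) *\<^sub>R op_power A (k + N)) \<le> B * q ^ N * (1/2) ^ k" for k
    proof -
      have "norm (\<beta> (k + N) *\<^sub>R op_power A (k + N)) \<le> \<bar>\<beta> (k + N)\<bar> * (norm A ^ (k + N) * norm I)"
        unfolding I_def norm_scaleR by (intro mult_left_mono norm_op_power_le abs_ge_zero)
      also have "\<dots> = (\<bar>\<beta> (k + N)\<bar> * (r/2) ^ (k + N) * norm I) * q ^ (k + N)"
        using r by (simp add: q_def field_simps)
      also have "\<dots> \<le> B * q ^ (k + N)" by (intro mult_right_mono coeff) (use q in auto)
      also have "\<dots> = B * q ^ N * q ^ k" by (simp add: power_add)
      also have "\<dots> \<le> B * q ^ N * (1/2) ^ k" using q B by (intro mult_left_mono power_mono) auto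
      finally show ?thesis .
    qed
    have "(\<lambda>k. \<beta> (k + N) *\<^sub>R op_power A (k + N)) sums (b A - (\<Sum>k<N. \<beta> k *\<^sub>R op_power A k))"
      by (rule sums_split_initial_segment, rule sums) (use A r in auto)
    moreover have "(\<lambda>k. B * q ^ N * (1/2) ^ k) sums (B * q ^ N * (1 / (1 - 1/2)))"
      by (intro sums_mult geometric_sums) auto
    ultimately have "norm (b A - (\<Sum>k<N. \<beta> k *\<^sub>R op_power A k)) \<le> B * q ^ N * (1 / (1 - 1/2))"
      using summand by (rule norm_sums_le)
    then show "norm (b A - (\<Sum>k<N. \<beta> k *\<^sub>R op_power A k)) \<le> 2 * B * (2/r) ^ N * norm A ^ N"
      by (simp add: q_def power_divide power_mult_distrib mult_ac)
  qed
qed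

lemma has_integral_one_minus_power:
  "((\<lambda>\<theta>. (1 - \<theta>) ^ k / fact k) has_integral 1 / fact (Suc k)) {0..1::real}"
proof -
  have "((\<lambda>\<theta>. - ((1 - \<theta>) ^ Suc k / fact (Suc k))) has_real_derivative (1 - \<theta>) ^ k / fact k)
      (at \<theta> within {0..1})" for \<theta> :: real
  proof -
    have "((\<lambda>\<theta>. - ((1 - \<theta>) ^ Suc k / fact (Suc k))) has_real_derivative
        real (Suc k) * (1 - \<theta>) ^ k / fact (Suc k)) (at \<theta> within {0..1})"
      by (auto intro!: derivative_eq_intros simp del: fact_Suc power_Suc)
    moreover have "real (Suc k) * (1 - \<theta>) ^ k / fact (Suc k) = (1 - \<theta>) ^ k / fact k"
      by (simp del: of_nat_Suc)
    ultimately show ?thesis by simp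
  qed
  then have "((\<lambda>\<theta>. (1 - \<theta>) ^ k / fact k) has_integral
      (- ((1 - 1) ^ Suc k / fact (Suc k)) - (- ((1 - 0) ^ Suc k / fact (Suc k)))) ) {0..1::real}"
    by (intro fundamental_theorem_of_calculus) (simp_all add: has_real_derivative_iff_has_vector_derivative)
  then show ?thesis by simp
qed

text \<open>The exponential series \<open>exp ((1 - \<theta>) A)\<close> converges uniformly for \<open>\<theta>\<close> in \<open>[0, 1]\<close>, so it may be
  integrated term by term.\<close>

lemma op_phi_1_expansion: "has_op_expansion (op_phi 1 :: ('a::banach \<Rightarrow>\<^sub>L 'a) \<Rightarrow> _) (\<lambda>k. 1 / fact (Suc k))"
proof -
  have "(\<lambda>k. (1 / fact (Suc k)) *\<^sub>R op_power A k) sums op_phi 1 A" for A :: "'a \<Rightarrow>\<^sub>L 'a"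
  proof -
    define S where "S n \<theta> = (\<Sum>k<n. ((1 - \<theta>) ^ k / fact k) *\<^sub>R op_power A k)" for n and \<theta> :: real
    have "summable (\<lambda>k. norm A ^ k / fact k)"
      using exp_converges[of "norm A"] by (auto simp: sums_iff field_simps)
    moreover have "norm (((1 - \<theta>) ^ k / fact k) *\<^sub>R op_power A k) \<le> norm A ^ k / fact k"
      if "\<theta> \<in> {0..1}" for k and \<theta> :: real
    proof -
      have "(1 - \<theta>) ^ k * norm (op_power A k) \<le> 1 * norm A ^ k"
        using that by (intro mult_mono norm_op_power_le_power) (auto intro: power_le_one)
      then show ?thesis using that by (simp add: divide_right_mono)
    qed
    ultimately have "uniform_limit {0..1} S (\<lambda>\<theta>. \<Sum>k. ((1 - \<theta>) ^ k / fact k) *\<^sub>R op_power A k) sequentially"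
      unfolding S_def by (intro Weierstrass_m_test[where M = "\<lambda>k. norm A ^ k / fact k"])
    then have unif: "uniform_limit {0..1} S (\<lambda>\<theta>. op_exp ((1 - \<theta>) *\<^sub>R A)) sequentially"
      by (simp add: op_exp_def op_power_scaleR)
    have cont: "continuous_on {0..1} (S n)" for n
      unfolding S_def by (intro continuous_intros) auto
    obtain I L where I: "\<And>n. (S n has_integral I n) {0..1}"
      and L: "((\<lambda>\<theta>. op_exp ((1 - \<theta>) *\<^sub>R A)) has_integral L) {0..1}" and lim: "I \<longlonglongrightarrow> L"
      using uniform_limit_integral[OF unif cont] by auto
    have "(S n has_integral (\<Sum>k<n. (1 / fact (Suc k)) *\<^sub>R op_power A k)) {0..1}" for n
      unfolding S_def
      by (intro has_integral_sum has_integral_scaleR_left has_integral_one_minus_power) auto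
    then have "I = (\<lambda>n. \<Sum>k<n. (1 / fact (Suc k)) *\<^sub>R op_power A k)"
      using I has_integral_unique by blast
    moreover have "op_phi 1 A = L" using L by (simp add: op_phi_def integral_unique)
    ultimately show ?thesis using lim by (simp add: sums_def)
  qed
  then show ?thesis unfolding has_op_expansion_def by (intro exI[of _ 1]) simp
qed

section \<open>The nonlinear increment along a curve with prescribed 2-jet\<close>

lemma norm_blinfun_le:
  assumes "norm A \<le> a" "norm x \<le> b"
  shows "norm (blinfun_apply A x) \<le> a * b"
  using norm_blinfun[of A x] mult_mono'[OF assms norm_ge_zero norm_ge_zero] by linarith

text \<open>The number \<open>Y\<close> bounds \<open>|y| / s\<close> for a vector \<open>y\<close> that differs from \<open>s f + (s^2/2) J f\<close> by at most
  \<open>K s^3\<close>.\<close>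

definition jet_const :: "real \<Rightarrow> real \<Rightarrow> real \<Rightarrow> real" where
  "jet_const l m K = (let Y = m + l * m + K in 3 * m * Y^2 + 3 * m * Y^3 + m * Y^4)"

text \<open>The data of a vector field at one point: \<open>f\<close> is its value and \<open>J\<close>, \<open>H\<close>, \<open>T\<close> are its first three
  derivatives. The bound for \<open>J\<close> is separate from the others because the error constant has to be
  expressed through it.\<close>

locale field_data =
  fixes l m :: real
    and J :: "'a::real_normed_vector \<Rightarrow>\<^sub>L 'a" and f :: 'a
    and H :: "'a \<Rightarrow>\<^sub>L 'a \<Rightarrow>\<^sub>L 'a" and T :: "'a \<Rightarrow>\<^sub>L 'a \<Rightarrow>\<^sub>L 'a \<Rightarrow>\<^sub>L 'a"
  assumes J: "norm J \<le> l" and f: "norm f \<le> m" and H: "norm H \<le> m" and T: "norm T \<le> m"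
begin

text \<open>The Taylor polynomial of the field without its constant and linear terms.\<close>

definition cubic :: "'a \<Rightarrow> 'a" where
  "cubic y = (1/2) *\<^sub>R H y y + (1/6) *\<^sub>R T y y y"

text \<open>The second and third derivative at \<open>0\<close> of \<open>s \<mapsto> cubic (y s)\<close>, where \<open>y\<close> is any curve with
  \<open>y 0 = 0\<close>, \<open>y' 0 = f\<close> and \<open>y'' 0 = J f\<close>.\<close>

definition incr2 :: 'a where "incr2 = H f f"

definition incr3 :: 'a where "incr3 = T f f f + (3/2) *\<^sub>R (H f (J f) + H (J f) f)"

lemma l_nonneg: "0 \<le> l" using J norm_ge_zero order_trans by blast
lemma m_nonneg: "0 \<le> m" using f norm_ge_zero order_trans by blast
lemma norm_Jf: "norm (J f) \<le> l * m" by (rule norm_blinfun_le[OF J f])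
lemma norm_H: "norm x \<le> p \<Longrightarrow> norm y \<le> q \<Longrightarrow> norm (H x y) \<le> m * p * q"
  by (intro norm_blinfun_le H)
lemma norm_T: "norm x \<le> p \<Longrightarrow> norm y \<le> q \<Longrightarrow> norm z \<le> r \<Longrightarrow> norm (T x y z) \<le> m * p * q * r"
  by (intro norm_blinfun_le T)

lemma norm_incr2: "norm incr2 \<le> m ^ 3"
  using norm_H[OF f f] by (simp add: incr2_def power3_eq_cube)

lemma norm_incr3: "norm incr3 \<le> m ^ 4 + 3 * l * m ^ 3"
proof -
  have "norm (T f f f) \<le> m ^ 4" using norm_T[OF f f f] by (simp add: eval_nat_numeral)
  moreover have "norm (H f (J f)) \<le> l * m ^ 3"
    using norm_H[OF f norm_Jf] by (simp add: power3_eq_cube mult_ac)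
  moreover have "norm (H (J f) f) \<le> l * m ^ 3"
    using norm_H[OF norm_Jf f] by (simp add: power3_eq_cube mult_ac)
  ultimately have "norm (T f f f) \<le> m ^ 4" and w: "norm (H f (J f) + H (J f) f) \<le> 2 * l * m ^ 3"
    using norm_triangle_ineq[of "H f (J f)" "H (J f) f"] by linarith+
  moreover have "norm ((3/2) *\<^sub>R (H f (J f) + H (J f) f)) \<le> 3 * l * m ^ 3"
    using w unfolding norm_scaleR by simp
  ultimately show ?thesis
    unfolding incr3_def
    using norm_triangle_ineq[of "T f f f" "(3/2) *\<^sub>R (H f (J f) + H (J f) f)"] by linarith
qed

lemma quadratic_bound:
  assumes q: "norm (q - cubic y) \<le> m * norm y ^ 4" and y: "norm y \<le> 1"
  shows "norm q \<le> 2 * m * norm y ^ 2"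
proof -
  let ?n = "norm y"
  have p: "?n ^ 3 \<le> ?n ^ 2" "?n ^ 4 \<le> ?n ^ 2" using y by (auto intro!: power_decreasing)
  have "norm (H y y) \<le> m * ?n ^ 2"
    using norm_H[of y ?n y ?n] by (simp add: power2_eq_square mult_ac)
  moreover have "norm (T y y y) \<le> m * ?n ^ 2"
    using norm_T[of y ?n y ?n y ?n] mult_left_mono[OF p(1) m_nonneg]
    by (simp add: power3_eq_cube mult_ac)
  moreover have "norm (q - cubic y) \<le> m * ?n ^ 2"
    using q mult_left_mono[OF p(2) m_nonneg] by linarith
  moreover have "norm (cubic y) \<le> (1/2) * norm (H y y) + (1/6) * norm (T y y y)"
    unfolding cubic_def by (rule order_trans[OF norm_triangle_ineq]) simp
  moreover have "norm q \<le> norm (q - cubic y) + norm (cubic y)"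
    using norm_triangle_ineq[of "q - cubic y" "cubic y"] by simp
  moreover have "0 \<le> m * ?n ^ 2" using m_nonneg by simp
  ultimately show ?thesis by linarith
qed

lemma two_jet_bound:
  assumes s: "0 \<le> s" "s \<le> 1" and K: "norm (y - s *\<^sub>R f - (s^2/2) *\<^sub>R J f) \<le> K * s^3"
  shows "norm y \<le> (m + l * m + K) * s" and "0 < s \<Longrightarrow> 0 \<le> K"
proof -
  show K0: "0 \<le> K" if "0 < s"
  proof -
    have "0 \<le> K * s^3" using K norm_ge_zero order_trans by blast
    then show ?thesis using zero_less_power[OF that, of 3] by (auto simp: zero_le_mult_iff)
  qed
  show "norm y \<le> (m + l * m + K) * s"
  proof (cases "s = 0")
    case True
    then show ?thesis using K by simp
  next
    case False
    then have s0: "0 < s" using s by simp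
    have "norm (s *\<^sub>R f) \<le> s * m" using s f by (simp add: mult_left_mono)
    moreover have "norm ((s^2/2) *\<^sub>R J f) \<le> s * (l * m)"
    proof -
      have "s^2 \<le> s" using s by (simp add: power2_eq_square mult_left_le)
      then have "s^2/2 \<le> s" using s by linarith
      then have "(s^2/2) * norm (J f) \<le> s * (l * m)"
        by (intro mult_mono norm_Jf) (use s in auto)
      then show ?thesis by simp
    qed
    moreover have "K * s^3 \<le> K * s"
      using K0[OF s0] s power_decreasing[of 1 3 s] by (intro mult_left_mono) auto
    moreover have "norm y \<le> norm (s *\<^sub>R f) + norm ((s^2/2) *\<^sub>R J f) + norm (y - s *\<^sub>R f - (s^2/2) *\<^sub>R J f)"
      using norm_triangle_ineq[of "s *\<^sub>R f + (s^2/2) *\<^sub>R J f" "y - s *\<^sub>R f - (s^2/2) *\<^sub>R J f"]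
        norm_triangle_ineq[of "s *\<^sub>R f" "(s^2/2) *\<^sub>R J f"] by simp
    ultimately show ?thesis using K by (simp add: algebra_simps)
  qed
qed

text \<open>Insert \<open>y = s f + e + r\<close>, with \<open>e\<close> of order \<open>s^2\<close> and \<open>r\<close> of order \<open>s^3\<close>, into \<open>H y y / 2\<close> and
  \<open>T y y y / 6\<close>. The terms of order below four in \<open>s\<close> are
  \<open>s^2 H f f / 2\<close>, \<open>s^3 (H f (J f) + H (J f) f) / 4\<close> and \<open>s^3 T f f f / 6\<close>; they add up to the
  polynomial subtracted below. The vector \<open>q\<close> stands for the
  increment of the nonlinear part of the field at \<open>y\<close>.\<close>

lemma increment_of_two_jet:
  assumes s: "0 \<le> s" "s \<le> 1" and K: "norm (y - s *\<^sub>R f - (s^2/2) *\<^sub>R J f) \<le> K * s^3"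
    and q: "norm (q - cubic y) \<le> m * norm y ^ 4"
  shows "norm (q - (s^2/2) *\<^sub>R incr2 - (s^3/6) *\<^sub>R incr3) \<le> jet_const l m K * s^4"
proof (cases "s = 0")
  case True
  then have "y = 0" using K by simp
  then show ?thesis using q True by (simp add: cubic_def blinfun.bilinear_simps)
next
  case False
  then have s0: "0 < s" using s by simp
  have K0: "0 \<le> K" by (rule two_jet_bound(2)[OF s K s0])
  define Y where "Y = m + l * m + K"
  have lm: "0 \<le> l * m" using l_nonneg m_nonneg by simp
  have Y: "m \<le> Y" "l * m \<le> Y" "K \<le> Y" "0 \<le> Y" "m + l * m \<le> Y" using K0 m_nonneg lm by (auto simp: Y_def)
  define e where "e = (s^2/2) *\<^sub>R J f"
  define r where "r = y - s *\<^sub>R f - e"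
  have y_eq: "y = s *\<^sub>R f + e + r" by (simp add: r_def)
  have ny: "norm y \<le> Y * s" unfolding Y_def by (rule two_jet_bound(1)[OF s K])
  have ne': "norm e \<le> (l * m) * s^2"
  proof -
    have "(s^2/2) * norm (J f) \<le> s^2 * (l * m)" by (intro mult_mono norm_Jf) auto
    then show ?thesis by (simp add: e_def mult_ac)
  qed
  have ne: "norm e \<le> Y * s^2" using ne' mult_right_mono[OF Y(2), of "s^2"] by simp
  have nr: "norm r \<le> Y * s^3" using K mult_right_mono[OF Y(3), of "s^3"] s by (simp add: r_def e_def)
  have ss: "s^2 \<le> s" "s^3 \<le> s^2" using s power_decreasing[of 1 2 s] power_decreasing[of 2 3 s] by auto
  have nfe: "norm (s *\<^sub>R f + e) \<le> Y * s"
  proof -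
    have "norm (s *\<^sub>R f + e) \<le> s * m + (l * m) * s^2"
      using norm_triangle_ineq[of "s *\<^sub>R f" e] ne' mult_left_mono[OF f s(1)] s by simp
    also have "\<dots> \<le> s * m + (l * m) * s" using lm ss by (intro add_left_mono mult_left_mono)
    also have "\<dots> \<le> Y * s" using mult_right_mono[OF Y(5) s(1)] by (simp add: algebra_simps)
    finally show ?thesis .
  qed
  have nd: "norm (e + r) \<le> Y * s^2"
  proof -
    have "norm (e + r) \<le> (l * m) * s^2 + K * s^3"
      using norm_triangle_ineq[of e r] ne' K by (simp add: r_def e_def)
    also have "\<dots> \<le> (l * m) * s^2 + K * s^2" using K0 ss by (intro add_left_mono mult_left_mono)
    also have "\<dots> = (l * m + K) * s^2" by (simp add: algebra_simps)
    also have "\<dots> \<le> Y * s^2" using m_nonneg by (intro mult_right_mono) (auto simp: Y_def)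
    finally show ?thesis .
  qed
  have nf: "norm (s *\<^sub>R f) \<le> Y * s" using mult_right_mono[OF order_trans[OF f Y(1)] s(1)] s by (simp add: mult_ac)
  \<comment> \<open>Both differences are written as sums of terms that are visibly of order four.\<close>
  have Hy: "H y y - s^2 *\<^sub>R incr2 - (s^3/2) *\<^sub>R (H f (J f) + H (J f) f) = H e e + H r y + H (s *\<^sub>R f + e) r"
    unfolding y_eq incr2_def e_def
    by (simp add: blinfun.bilinear_simps algebra_simps power2_eq_square power3_eq_cube)
  have nH: "norm (H y y - s^2 *\<^sub>R incr2 - (s^3/2) *\<^sub>R (H f (J f) + H (J f) f)) \<le> 3 * m * Y^2 * s^4"
  proof -
    have "norm (H e e) \<le> m * Y^2 * s^4" "norm (H r y) \<le> m * Y^2 * s^4"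
      "norm (H (s *\<^sub>R f + e) r) \<le> m * Y^2 * s^4"
      using norm_H[OF ne ne] norm_H[OF nr ny] norm_H[OF nfe nr]
      by (simp_all add: eval_nat_numeral mult_ac)
    then show ?thesis unfolding Hy
      using norm_triangle_ineq[of "H e e + H r y" "H (s *\<^sub>R f + e) r"] norm_triangle_ineq[of "H e e" "H r y"]
      by linarith
  qed
  have Ty: "T y y y - s^3 *\<^sub>R T f f f = T (e + r) y y + T (s *\<^sub>R f) (e + r) y + T (s *\<^sub>R f) (s *\<^sub>R f) (e + r)"
    unfolding y_eq by (simp add: blinfun.bilinear_simps algebra_simps power3_eq_cube)
  have nT: "norm (T y y y - s^3 *\<^sub>R T f f f) \<le> 3 * m * Y^3 * s^4"
  proof -
    have "norm (T (e + r) y y) \<le> m * Y^3 * s^4" "norm (T (s *\<^sub>R f) (e + r) y) \<le> m * Y^3 * s^4"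
      "norm (T (s *\<^sub>R f) (s *\<^sub>R f) (e + r)) \<le> m * Y^3 * s^4"
      using norm_T[OF nd ny ny] norm_T[OF nf nd ny] norm_T[OF nf nf nd]
      by (simp_all add: eval_nat_numeral mult_ac)
    then show ?thesis unfolding Ty
      using norm_triangle_ineq[of "T (e + r) y y + T (s *\<^sub>R f) (e + r) y" "T (s *\<^sub>R f) (s *\<^sub>R f) (e + r)"]
        norm_triangle_ineq[of "T (e + r) y y" "T (s *\<^sub>R f) (e + r) y"]
      by linarith
  qed
  have nq: "norm (q - cubic y) \<le> m * Y^4 * s^4"
  proof -
    have "norm y ^ 4 \<le> (Y * s) ^ 4" by (intro power_mono ny norm_ge_zero)
    then show ?thesis using q mult_left_mono[OF _ m_nonneg, of "norm y ^ 4" "(Y * s) ^ 4"]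
      by (simp add: power_mult_distrib mult_ac)
  qed
  let ?h = "H y y - s^2 *\<^sub>R incr2 - (s^3/2) *\<^sub>R (H f (J f) + H (J f) f)" and ?t = "T y y y - s^3 *\<^sub>R T f f f"
  have "q - (s^2/2) *\<^sub>R incr2 - (s^3/6) *\<^sub>R incr3 = (q - cubic y) + ((1/2) *\<^sub>R ?h + (1/6) *\<^sub>R ?t)"
    unfolding cubic_def incr3_def by (simp add: algebra_simps)
  then have "norm (q - (s^2/2) *\<^sub>R incr2 - (s^3/6) *\<^sub>R incr3) \<le> norm (q - cubic y) + (\<bar>1/2\<bar> * norm ?h + \<bar>1/6\<bar> * norm ?t)"
    using norm_triangle_ineq[of "q - cubic y" "(1/2) *\<^sub>R ?h + (1/6) *\<^sub>R ?t"]
      norm_triangle_ineq[of "(1/2) *\<^sub>R ?h" "(1/6) *\<^sub>R ?t"] by (simp only: norm_scaleR)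
  also have "\<dots> \<le> m * Y^4 * s^4 + (3 * m * Y^2 * s^4 + 3 * m * Y^3 * s^4)"
    using nq nH nT norm_ge_zero[of ?h] norm_ge_zero[of ?t] by linarith
  also have "\<dots> = jet_const l m K * s^4" by (simp add: jet_const_def Let_def Y_def algebra_simps)
  finally show ?thesis .
qed

end

section \<open>Expansion of the exact solution\<close>

text \<open>The numbers \<open>K1\<close>, \<open>K2\<close>, \<open>K3\<close> are the constants of the successive expansions of the solution with
  remainders of order \<open>s^2\<close>, \<open>s^3\<close>, \<open>s^4\<close>.\<close>

definition flow_const :: "real \<Rightarrow> real \<Rightarrow> real" where
  "flow_const l m =
    (let K1 = l * m + 2 * m^3; K2 = l * K1 + 2 * m^3; c = jet_const l m K2;
         K3 = l * K2 + c + (m^4 + 3 * l * m^3)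
     in l * K3 + c)"

context field_data
begin

text \<open>Bootstrapping: if \<open>y\<close> is known up to \<open>O(s^k)\<close>, then \<open>J y\<close> is known to the same order, and so is
  \<open>q s\<close>: by \<open>quadratic_bound\<close> as long as \<open>k \<le> 2\<close>, and by \<open>increment_of_two_jet\<close> afterwards.
  Subtracting the derivative of the next polynomial leaves a remainder of order \<open>s^k\<close> in \<open>y'\<close>, hence of order \<open>s^(k+1)\<close> in \<open>y\<close>.\<close>

lemma flow_expansion:
  assumes h: "0 \<le> h" "h \<le> 1" "m * h \<le> 1"
    and der: "\<And>s. s \<in> {0..h} \<Longrightarrow> (y has_vector_derivative f + J (y s) + q s) (at s within {0..h})"
    and zero: "y 0 = 0"
    and y: "\<And>s. s \<in> {0..h} \<Longrightarrow> norm (y s) \<le> m * s"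
    and q: "\<And>s. s \<in> {0..h} \<Longrightarrow> norm (q s - cubic (y s)) \<le> m * norm (y s) ^ 4"
  shows "norm (y h - h *\<^sub>R f - (h^2/2) *\<^sub>R J f - (h^3/6) *\<^sub>R (J (J f) + incr2)
      - (h^4/24) *\<^sub>R (J (J (J f)) + J incr2 + incr3)) \<le> flow_const l m * h^5"
proof -
  define K1 where "K1 = l * m + 2 * m^3"
  define K2 where "K2 = l * K1 + 2 * m^3"
  define c where "c = jet_const l m K2"
  define K3 where "K3 = l * K2 + c + (m^4 + 3 * l * m^3)"
  define K4 where "K4 = l * K3 + c"
  have q2: "norm (q s) \<le> 2 * m^3 * s^2" if s: "s \<in> {0..h}" for s
  proof -
    have "norm (y s) \<le> 1"
      using y[OF s] mult_left_mono[OF _ m_nonneg, of s h] s h by auto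
    then have "norm (q s) \<le> 2 * m * norm (y s) ^ 2" by (rule quadratic_bound[OF q[OF s]])
    also have "\<dots> \<le> 2 * m * (m * s) ^ 2"
      using m_nonneg by (intro mult_left_mono power_mono y[OF s]) auto
    finally show ?thesis by (simp add: power_mult_distrib power2_eq_square power3_eq_cube mult_ac)
  qed
  have q1: "norm (q s) \<le> 2 * m^3 * s" if s: "s \<in> {0..h}" for s
  proof -
    have "2 * m^3 * s^2 \<le> 2 * m^3 * s"
      using s h m_nonneg by (intro mult_left_mono) (auto simp: power2_eq_square mult_left_le)
    then show ?thesis using q2[OF s] by linarith
  qed
  have Jle: "norm (J z) \<le> l * e" if "norm z \<le> e" for z e by (rule norm_blinfun_le[OF J that])
  have tri: "norm (x + z) \<le> p + r" if "norm x \<le> p" "norm z \<le> r" for x z :: 'a and p r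
    using norm_triangle_ineq[of x z] that by linarith

  have e1: "norm (y s - s *\<^sub>R f) \<le> K1 * s ^ Suc 1" if "s \<in> {0..h}" for s
  proof (rule norm_le_power_Suc[OF _ _ _ that])
    fix s assume s: "s \<in> {0..h}"
    show "((\<lambda>s. y s - s *\<^sub>R f) has_vector_derivative J (y s) + q s) (at s within {0..h})"
      by (auto intro!: derivative_eq_intros der[OF s])
    show "norm (J (y s) + q s) \<le> K1 * s ^ 1"
      using tri[OF Jle[OF y[OF s]] q1[OF s]] by (simp add: K1_def algebra_simps)
  qed (simp add: zero)

  have e2: "norm (y s - s *\<^sub>R f - (s^2/2) *\<^sub>R J f) \<le> K2 * s ^ Suc 2" if "s \<in> {0..h}" for s
  proof (rule norm_le_power_Suc[OF _ _ _ that])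
    fix s assume s: "s \<in> {0..h}"
    show "((\<lambda>s. y s - s *\<^sub>R f - (s^2/2) *\<^sub>R J f) has_vector_derivative J (y s - s *\<^sub>R f) + q s) (at s within {0..h})"
      by (auto intro!: derivative_eq_intros der[OF s] simp: blinfun.bilinear_simps)
    show "norm (J (y s - s *\<^sub>R f) + q s) \<le> K2 * s ^ 2"
      using tri[OF Jle[OF e1[OF s]] q2[OF s]] by (simp add: K2_def algebra_simps power2_eq_square)
  qed (simp add: zero)

  have jet: "norm (q s - (s^2/2) *\<^sub>R incr2 - (s^3/6) *\<^sub>R incr3) \<le> c * s^4" if s: "s \<in> {0..h}" for s
    unfolding c_def by (rule increment_of_two_jet[OF _ _ _ q[OF s]]) (use s h e2[OF s] in \<open>auto simp: eval_nat_numeral\<close>)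
  have c0: "0 \<le> c" if "s \<in> {0..h}" "0 < s" for s
  proof -
    have "0 \<le> c * s^4" using jet[OF that(1)] norm_ge_zero order_trans by blast
    then show ?thesis using zero_less_power[OF that(2), of 4] by (auto simp: zero_le_mult_iff)
  qed
  have q3: "norm (q s - (s^2/2) *\<^sub>R incr2) \<le> (c + (m^4 + 3 * l * m^3)) * s^3" if s: "s \<in> {0..h}" for s
  proof (cases "s = 0")
    case True
    then show ?thesis using jet[OF s] by simp
  next
    case False
    then have "c * s^4 \<le> c * s^3"
      using c0[OF s] s h by (intro mult_left_mono power_decreasing) auto
    moreover have "norm ((s^3/6) *\<^sub>R incr3) \<le> s^3 * (m^4 + 3 * l * m^3)"
    proof -
      have "(s^3/6) * norm incr3 \<le> s^3 * (m^4 + 3 * l * m^3)"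
        using s by (intro mult_mono norm_incr3) auto
      then show ?thesis using s by simp
    qed
    ultimately show ?thesis
      using tri[OF order_trans[OF jet[OF s]], of "c * s^3" "(s^3/6) *\<^sub>R incr3" "s^3 * (m^4 + 3 * l * m^3)"]
      by (simp add: algebra_simps)
  qed

  have e3: "norm (y s - s *\<^sub>R f - (s^2/2) *\<^sub>R J f - (s^3/6) *\<^sub>R (J (J f) + incr2)) \<le> K3 * s ^ Suc 3"
    if "s \<in> {0..h}" for s
  proof (rule norm_le_power_Suc[OF _ _ _ that])
    fix s assume s: "s \<in> {0..h}"
    show "((\<lambda>s. y s - s *\<^sub>R f - (s^2/2) *\<^sub>R J f - (s^3/6) *\<^sub>R (J (J f) + incr2)) has_vector_derivative
        J (y s - s *\<^sub>R f - (s^2/2) *\<^sub>R J f) + (q s - (s^2/2) *\<^sub>R incr2)) (at s within {0..h})"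
      by (auto intro!: derivative_eq_intros der[OF s] simp: blinfun.bilinear_simps algebra_simps)
    show "norm (J (y s - s *\<^sub>R f - (s^2/2) *\<^sub>R J f) + (q s - (s^2/2) *\<^sub>R incr2)) \<le> K3 * s ^ 3"
      using tri[OF Jle[OF e2[OF s]] q3[OF s]] by (simp add: K3_def algebra_simps eval_nat_numeral)
  qed (simp add: zero)

  have e4: "norm (y s - s *\<^sub>R f - (s^2/2) *\<^sub>R J f - (s^3/6) *\<^sub>R (J (J f) + incr2)
      - (s^4/24) *\<^sub>R (J (J (J f)) + J incr2 + incr3)) \<le> K4 * s ^ Suc 4"
    if "s \<in> {0..h}" for s
  proof (rule norm_le_power_Suc[OF _ _ _ that])
    fix s assume s: "s \<in> {0..h}"
    show "((\<lambda>s. y s - s *\<^sub>R f - (s^2/2) *\<^sub>R J f - (s^3/6) *\<^sub>R (J (J f) + incr2)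
        - (s^4/24) *\<^sub>R (J (J (J f)) + J incr2 + incr3)) has_vector_derivative
        J (y s - s *\<^sub>R f - (s^2/2) *\<^sub>R J f - (s^3/6) *\<^sub>R (J (J f) + incr2))
          + (q s - (s^2/2) *\<^sub>R incr2 - (s^3/6) *\<^sub>R incr3)) (at s within {0..h})"
      by (auto intro!: derivative_eq_intros der[OF s] simp: blinfun.bilinear_simps algebra_simps)
    show "norm (J (y s - s *\<^sub>R f - (s^2/2) *\<^sub>R J f - (s^3/6) *\<^sub>R (J (J f) + incr2))
          + (q s - (s^2/2) *\<^sub>R incr2 - (s^3/6) *\<^sub>R incr3)) \<le> K4 * s ^ 4"
      using tri[OF Jle[OF e3[OF s]] jet[OF s]] by (simp add: K4_def algebra_simps eval_nat_numeral)
  qed (simp add: zero)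
  have "K4 = flow_const l m"
    by (simp add: flow_const_def Let_def K1_def K2_def c_def K3_def K4_def)
  then show ?thesis using e4[of h] h(1) by (simp add: eval_nat_numeral)
qed

end

section \<open>Expansion of the numerical step\<close>

text \<open>Here \<open>P\<close> stands for \<open>\<phi>\<^sub>1(s J)\<close>. The conclusion is the hypothesis of \<open>increment_of_two_jet\<close>, so the
  stage agrees with the exact solution to the order that the increment can see.\<close>

lemma stage_two_jet:
  fixes P :: "'a::real_normed_vector \<Rightarrow>\<^sub>L 'a"
  assumes P: "norm (P - id_blinfun - (1/2) *\<^sub>R (s *\<^sub>R J)) \<le> K * norm (s *\<^sub>R J) ^ 2"
    and J: "norm J \<le> l" and f: "norm f \<le> m" and s: "0 \<le> s" and K: "0 \<le> K"
  shows "norm (s *\<^sub>R P f - s *\<^sub>R f - (s^2/2) *\<^sub>R J f) \<le> K * l^2 * m * s^3"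
proof -
  have "norm (s *\<^sub>R J) \<le> s * l" using J s by (simp add: mult_left_mono)
  then have "norm (s *\<^sub>R J) ^ 2 \<le> (s * l) ^ 2" by (intro power_mono) auto
  then have "norm (P - id_blinfun - (1/2) *\<^sub>R (s *\<^sub>R J)) \<le> K * (s * l) ^ 2"
    using P mult_left_mono[OF _ K] order_trans by blast
  from norm_blinfun_le[OF this f] s
  have "norm (s *\<^sub>R (P - id_blinfun - (1/2) *\<^sub>R (s *\<^sub>R J)) f) \<le> s * (K * (s * l) ^ 2 * m)"
    by (simp add: mult_left_mono)
  moreover have "s *\<^sub>R (P - id_blinfun - (1/2) *\<^sub>R (s *\<^sub>R J)) f = s *\<^sub>R P f - s *\<^sub>R f - (s^2/2) *\<^sub>R J f"
    by (simp add: blinfun.bilinear_simps algebra_simps power2_eq_square)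
  moreover have "s * (K * (s * l) ^ 2 * m) = K * l^2 * m * s^3"
    by (simp add: eval_nat_numeral)
  ultimately show ?thesis by metis
qed

context field_data
begin

lemma exponential_Euler_expansion:
  assumes P: "norm (P - id_blinfun - (1/2) *\<^sub>R (h *\<^sub>R J) - (1/6) *\<^sub>R ((h *\<^sub>R J) o\<^sub>L (h *\<^sub>R J))
      - (1/24) *\<^sub>R ((h *\<^sub>R J) o\<^sub>L ((h *\<^sub>R J) o\<^sub>L (h *\<^sub>R J)))) \<le> K * norm (h *\<^sub>R J) ^ 4"
    and h: "0 \<le> h" and K: "0 \<le> K"
  shows "norm (h *\<^sub>R P f - h *\<^sub>R f - (h^2/2) *\<^sub>R J f - (h^3/6) *\<^sub>R J (J f) - (h^4/24) *\<^sub>R J (J (J f)))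
    \<le> K * l^4 * m * h^5"
proof -
  let ?R = "P - id_blinfun - (1/2) *\<^sub>R (h *\<^sub>R J) - (1/6) *\<^sub>R ((h *\<^sub>R J) o\<^sub>L (h *\<^sub>R J))
      - (1/24) *\<^sub>R ((h *\<^sub>R J) o\<^sub>L ((h *\<^sub>R J) o\<^sub>L (h *\<^sub>R J)))"
  have "norm (h *\<^sub>R J) \<le> h * l" using J h by (simp add: mult_left_mono)
  then have "norm (h *\<^sub>R J) ^ 4 \<le> (h * l) ^ 4" by (intro power_mono) auto
  then have "norm ?R \<le> K * (h * l) ^ 4"
    using P mult_left_mono[OF _ K] order_trans by blast
  from norm_blinfun_le[OF this f] h
  have "norm (h *\<^sub>R ?R f) \<le> h * (K * (h * l) ^ 4 * m)"
    by (simp add: mult_left_mono)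
  moreover have "h *\<^sub>R ?R f = h *\<^sub>R P f - h *\<^sub>R f - (h^2/2) *\<^sub>R J f - (h^3/6) *\<^sub>R J (J f) - (h^4/24) *\<^sub>R J (J (J f))"
    by (simp add: blinfun.bilinear_simps algebra_simps eval_nat_numeral)
  moreover have "h * (K * (h * l) ^ 4 * m) = K * l^4 * m * h^5"
    by (simp add: eval_nat_numeral)
  ultimately show ?thesis by metis
qed

text \<open>Here \<open>D\<close> is the nonlinear increment at the stage, \<open>S\<close> is \<open>b\<^sub>2(h J)\<close>, and \<open>s = c\<^sub>2 h\<close>. The order
  conditions enter the estimate only here: \<open>\<beta>0 s^2/2 = h^2/6\<close>, \<open>\<beta>0 s^3/6 = h^3/24\<close> and
  \<open>\<beta>1 s^2/2 = h^2/24\<close>.\<close>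

lemma correction_expansion:
  assumes D: "norm (D - (s^2/2) *\<^sub>R incr2 - (s^3/6) *\<^sub>R incr3) \<le> C * s^4"
    and S: "norm (S - \<beta>0 *\<^sub>R id_blinfun - \<beta>1 *\<^sub>R (h *\<^sub>R J)) \<le> K * norm (h *\<^sub>R J) ^ 2"
    and h: "0 \<le> h" "h \<le> 1" and s: "s = (3/4) * h" and C: "0 \<le> C" and K: "0 \<le> K"
    and \<beta>: "\<beta>0 = 16/27" "\<beta>1 = 4/27"
  shows "norm (h *\<^sub>R S D - (h^3/6) *\<^sub>R incr2 - (h^4/24) *\<^sub>R (J incr2 + incr3))
    \<le> (C + l * (m^4 + 3 * l * m^3) + l * C + K * l^2 * (m^3 + (m^4 + 3 * l * m^3) + C)) * h^5"
proof -
  define nb where "nb = m^4 + 3 * l * m^3"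
  have nb: "norm incr3 \<le> nb" "0 \<le> nb" using norm_incr3 l_nonneg m_nonneg by (auto simp: nb_def)
  define E where "E = D - (s^2/2) *\<^sub>R incr2 - (s^3/6) *\<^sub>R incr3"
  define R where "R = S - \<beta>0 *\<^sub>R id_blinfun - \<beta>1 *\<^sub>R (h *\<^sub>R J)"
  have sh: "0 \<le> s" "s \<le> h" using s h by auto
  have E: "norm E \<le> C * h^4"
    using D mult_left_mono[OF power_mono[OF sh(2,1), of 4] C] by (simp add: E_def)
  have R: "norm R \<le> K * (l^2 * h^2)"
  proof -
    have "norm (h *\<^sub>R J) \<le> l * h" using J h by (simp add: mult_left_mono mult.commute)
    then have "norm (h *\<^sub>R J) ^ 2 \<le> (l * h) ^ 2" by (intro power_mono) auto
    then show ?thesis using S mult_left_mono[OF _ K] order_trans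
      unfolding R_def power_mult_distrib by blast
  qed
  have pw: "h ^ Suc k \<le> h ^ k" for k using h by (simp add: mult_left_le_one_le)
  have D': "norm D \<le> (m^3 + nb + C) * h^2"
  proof -
    have 1: "norm ((s^2/2) *\<^sub>R incr2) \<le> h^2 * m^3"
    proof -
      have "s^2/2 \<le> h^2"
        using power_mono[OF sh(2,1), of 2] zero_le_power2[of h] by linarith
      then have "(s^2/2) * norm incr2 \<le> h^2 * m^3" by (intro mult_mono norm_incr2) auto
      then show ?thesis by simp
    qed
    have p: "s^3 \<le> h^2" "h^4 \<le> h^2"
      using power_mono[OF sh(2,1), of 3] pw[of 2] pw[of 3] by (auto simp: eval_nat_numeral)
    have 2: "norm ((s^3/6) *\<^sub>R incr3) \<le> h^2 * nb"
    proof -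
      have "s^3/6 \<le> h^2" using p(1) zero_le_power2[of h] by linarith
      then have "(s^3/6) * norm incr3 \<le> h^2 * nb" by (intro mult_mono nb) auto
      then show ?thesis using sh by simp
    qed
    have 3: "norm E \<le> h^2 * C" using E mult_left_mono[OF p(2) C] by (simp add: mult_ac)
    have "D = ((s^2/2) *\<^sub>R incr2 + (s^3/6) *\<^sub>R incr3) + E" by (simp add: E_def)
    then have "norm D \<le> norm ((s^2/2) *\<^sub>R incr2) + norm ((s^3/6) *\<^sub>R incr3) + norm E"
      using norm_triangle_ineq[of "(s^2/2) *\<^sub>R incr2 + (s^3/6) *\<^sub>R incr3" E]
        norm_triangle_ineq[of "(s^2/2) *\<^sub>R incr2" "(s^3/6) *\<^sub>R incr3"] by simp
    then show ?thesis using 1 2 3 by (simp add: algebra_simps)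
  qed
  have eq: "h *\<^sub>R S D - (h^3/6) *\<^sub>R incr2 - (h^4/24) *\<^sub>R (J incr2 + incr3) =
      (h * \<beta>0) *\<^sub>R E + (\<beta>1 * h^2 * (s^3/6)) *\<^sub>R J incr3 + (\<beta>1 * h^2) *\<^sub>R J E + h *\<^sub>R R D"
  proof -
    have "h *\<^sub>R S D = (h * \<beta>0) *\<^sub>R D + (\<beta>1 * h^2) *\<^sub>R J D + h *\<^sub>R R D"
      by (simp add: R_def blinfun.bilinear_simps algebra_simps power2_eq_square)
    also have "(h * \<beta>0) *\<^sub>R D = (h * \<beta>0) *\<^sub>R E + (h^3/6) *\<^sub>R incr2 + (h^4/24) *\<^sub>R incr3"
      by (simp add: E_def s \<beta> algebra_simps eval_nat_numeral)
    also have "(\<beta>1 * h^2) *\<^sub>R J D = (h^4/24) *\<^sub>R J incr2 + (\<beta>1 * h^2 * (s^3/6)) *\<^sub>R J incr3 + (\<beta>1 * h^2) *\<^sub>R J E"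
      by (simp add: E_def s \<beta> blinfun.bilinear_simps algebra_simps eval_nat_numeral)
    finally show ?thesis by (simp add: algebra_simps)
  qed
  have n1: "norm ((h * \<beta>0) *\<^sub>R E) \<le> C * h^5"
  proof -
    have "h * \<beta>0 \<le> h" using h unfolding \<beta> by linarith
    then have "(h * \<beta>0) * norm E \<le> h * (C * h^4)" using h by (intro mult_mono E) auto
    then show ?thesis using h unfolding \<beta> by (simp add: eval_nat_numeral mult_ac)
  qed
  have n2: "norm ((\<beta>1 * h^2 * (s^3/6)) *\<^sub>R J incr3) \<le> l * nb * h^5"
  proof -
    have eq: "\<beta>1 * h^2 * (s^3/6) = (1/96) * h^5" by (simp add: \<beta> s eval_nat_numeral)
    have "((1/96) * h^5) * norm (J incr3) \<le> h^5 * (l * nb)"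
      using h by (intro mult_mono norm_blinfun_le J nb) auto
    then show ?thesis using h unfolding eq norm_scaleR by (simp add: mult_ac)
  qed
  have n3: "norm ((\<beta>1 * h^2) *\<^sub>R J E) \<le> l * C * h^5"
  proof -
    have "h^2 \<le> h" using pw[of 1] by (simp add: power2_eq_square)
    then have "\<beta>1 * h^2 \<le> h" using zero_le_power2[of h] unfolding \<beta> by linarith
    then have "(\<beta>1 * h^2) * norm (J E) \<le> h * (l * (C * h^4))"
      using h by (intro mult_mono norm_blinfun_le J E) auto
    then show ?thesis unfolding \<beta> by (simp add: eval_nat_numeral mult_ac)
  qed
  have n4: "norm (h *\<^sub>R R D) \<le> K * l^2 * (m^3 + nb + C) * h^5"
  proof -
    have "h * norm (R D) \<le> h * ((K * (l^2 * h^2)) * ((m^3 + nb + C) * h^2))"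
      by (intro mult_left_mono norm_blinfun_le R D' h)
    then show ?thesis using h by (simp add: eval_nat_numeral mult_ac)
  qed
  have "norm (h *\<^sub>R S D - (h^3/6) *\<^sub>R incr2 - (h^4/24) *\<^sub>R (J incr2 + incr3))
      \<le> C * h^5 + l * nb * h^5 + l * C * h^5 + K * l^2 * (m^3 + nb + C) * h^5"
    unfolding eq by (intro order_trans[OF norm_triangle_ineq] add_mono n1 n2 n3 n4)
  then show ?thesis unfolding nb_def[symmetric] by (simp add: algebra_simps)
qed

end

section \<open>The local error\<close>

text \<open>The constant of \<open>correction_expansion\<close>; its argument \<open>C\<close> bounds the remainder of the increment at
  the stage and \<open>K\<close> the remainder of \<open>b\<^sub>2\<close>.\<close>

definition correction_const :: "real \<Rightarrow> real \<Rightarrow> real \<Rightarrow> real \<Rightarrow> real" where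
  "correction_const l m K C =
     C + l * (m^4 + 3 * l * m^3) + l * C + K * l^2 * (m^3 + (m^4 + 3 * l * m^3) + C)"

text \<open>The quotient of the first two conditions determines the node.\<close>

lemma order_conditions_iff:
  "order_conditions c2 \<beta> \<longleftrightarrow> c2 = 3/4 \<and> \<beta> 0 = 16/27 \<and> \<beta> 1 = 4/27"
proof
  assume "order_conditions c2 \<beta>"
  then have 1: "\<beta> 0 * c2 ^ 2 = 1/3" and 2: "\<beta> 0 * c2 ^ 3 = 1/4" and 3: "\<beta> 1 * c2 ^ 2 = 1/12"
    by (simp_all add: order_conditions_def fact_numeral)
  have "\<beta> 0 * c2 ^ 3 = (\<beta> 0 * c2 ^ 2) * c2" by (simp add: eval_nat_numeral)
  then have c: "c2 = 3/4" using 1 2 by simp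
  then show "c2 = 3/4 \<and> \<beta> 0 = 16/27 \<and> \<beta> 1 = 4/27"
    using 1 3 unfolding c by (simp add: power2_eq_square field_simps)
next
  assume r: "c2 = 3/4 \<and> \<beta> 0 = 16/27 \<and> \<beta> 1 = 4/27"
  then have eqs: "c2 = 3/4" "\<beta> 0 = 16/27" "\<beta> 1 = 4/27" by blast+
  show "order_conditions c2 \<beta>"
    unfolding order_conditions_def eqs by (simp add: fact_numeral power2_eq_square power3_eq_cube)
qed

text \<open>The hypotheses on \<open>h\<close> with \<open>\<delta>\<close> keep the exact solution and the stage inside the ball of radius \<open>\<delta>\<close>
  about the starting value, which lies in the strip where \<open>F\<close> is smooth; the one with \<open>m * h \<le> 1\<close> lets
  \<open>flow_expansion\<close> bound the increment by its quadratic part. The three expansions of operator functions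
  are stated for operators of norm at most \<open>l * h\<close>, because that is where the scheme evaluates them.\<close>

lemma local_error_bound:
  fixes F :: "'a::banach \<Rightarrow> 'a"
  assumes ivp: "solves_ivp F t0 u0 T u" and u: "smooth_solution M T u"
    and F: "smooth_field M (strip u T \<delta>) F" and \<delta>: "0 < \<delta>"
    and Mm: "M \<le> m" and L: "norm (fderiv F (u (grid t0 h n))) \<le> l"
    and h: "0 < h" "h \<le> 1" "m * h \<le> 1" "m * h < \<delta>" and grid: "grid t0 h (Suc n) \<le> T"
    and \<phi>2: "\<And>A :: 'a \<Rightarrow>\<^sub>L 'a. norm A \<le> l * h \<Longrightarrow>
      norm (op_phi 1 A - id_blinfun - (1/2) *\<^sub>R A) \<le> K2 * norm A ^ 2"
    and \<phi>4: "\<And>A :: 'a \<Rightarrow>\<^sub>L 'a. norm A \<le> l * h \<Longrightarrow>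
      norm (op_phi 1 A - id_blinfun - (1/2) *\<^sub>R A - (1/6) *\<^sub>R (A o\<^sub>L A) - (1/24) *\<^sub>R (A o\<^sub>L (A o\<^sub>L A)))
        \<le> K4 * norm A ^ 4"
    and b2: "\<And>A :: 'a \<Rightarrow>\<^sub>L 'a. norm A \<le> l * h \<Longrightarrow>
      norm (b2 A - (16/27) *\<^sub>R id_blinfun - (4/27) *\<^sub>R A) \<le> Kb * norm A ^ 2"
    and K: "0 \<le> K2" "0 \<le> K4" "0 \<le> Kb"
    and stage: "(m + l * m + K2 * l^2 * m) * h < \<delta>"
  shows "norm (local_error F (3/4) b2 u t0 h n) \<le>
    (K4 * l^4 * m + correction_const l m Kb (jet_const l m (K2 * l^2 * m)) + flow_const l m) * h^5"
proof -
  define \<tau> where "\<tau> = grid t0 h n"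
  define v where "v = u \<tau>"
  have T0: "0 < T" and t0: "0 \<le> t0"
    and ode: "\<And>t. t \<in> {0..T} \<Longrightarrow> (u has_vector_derivative F (u t)) (at t within {0..T})"
    using ivp by (auto simp: solves_ivp_def)
  have next_grid: "grid t0 h (Suc n) = \<tau> + h" by (simp add: \<tau>_def grid_def algebra_simps)
  have \<tau>: "0 \<le> \<tau>" "\<tau> + h \<le> T" using t0 h grid next_grid by (auto simp: \<tau>_def grid_def)
  have F_le: "norm (F (u t)) \<le> m" if "t \<in> {0..T}" for t
  proof -
    have "tderiv T 1 u t = F (u t)"
      using vector_derivative_within_cbox[of 0 T t u "F (u t)"] ode[OF that] T0 that by (simp add: tderiv_def)
    moreover have "norm (tderiv T 1 u t) \<le> M" using u that by (auto simp: smooth_solution_def)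
    ultimately show ?thesis using Mm by simp
  qed
  have ball: "x \<in> strip u T \<delta>" if "x \<in> ball v \<delta>" for x
    using that \<tau> h by (auto simp: strip_def v_def dist_norm norm_minus_commute intro!: bexI[of _ \<tau>])
  have v: "v \<in> ball v \<delta>" using \<delta> by simp
  have field: "F differentiable (at x)" "fderiv F differentiable (at x)"
      "fderiv (fderiv F) differentiable (at x)" "fderiv (fderiv (fderiv F)) differentiable (at x)"
      "norm (fderiv (fderiv F) x) \<le> m" "norm (fderiv (fderiv (fderiv F)) x) \<le> m"
      "norm (fderiv (fderiv (fderiv (fderiv F))) x) \<le> m"
    if "x \<in> ball v \<delta>" for x
    using F ball[OF that] Mm by (auto simp: smooth_field_def intro: order_trans)
  interpret field_data l m "fderiv F v" "F v" "fderiv (fderiv F) v" "fderiv (fderiv (fderiv F)) v"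
    using L F_le[of \<tau>] \<tau> h field[OF v] by unfold_locales (auto simp: v_def \<tau>_def)
  define J where "J = fderiv F v"
  define Q where "Q y = F (v + y) - F v - J y" for y
  have Q: "norm (Q y - cubic y) \<le> m * norm y ^ 4" if "norm y < \<delta>" for y
  proof -
    have "norm (F (v + y) - F v - fderiv F v y - (1/2) *\<^sub>R fderiv (fderiv F) v y y
            - (1/6) *\<^sub>R fderiv (fderiv (fderiv F)) v y y y) \<le> m * norm y ^ 4"
      by (rule Taylor_third_order_fderiv[OF _ _ _ _ _ that])
        (use field in blast)+
    then show ?thesis by (simp add: Q_def J_def cubic_def diff_diff_eq add.assoc)
  qed
  define K where "K = K2 * l^2 * m"
  have K0: "0 \<le> K" using K l_nonneg m_nonneg by (simp add: K_def)

  have exact: "norm (u (\<tau> + h) - v - h *\<^sub>R F v - (h^2/2) *\<^sub>R J (F v) - (h^3/6) *\<^sub>R (J (J (F v)) + incr2)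
      - (h^4/24) *\<^sub>R (J (J (J (F v))) + J incr2 + incr3)) \<le> flow_const l m * h^5"
  proof -
    define y where "y s = u (\<tau> + s) - v" for s
    have der: "(y has_vector_derivative F (u (\<tau> + s))) (at s within {0..h})" if s: "s \<in> {0..h}" for s
    proof -
      have "\<tau> + s \<in> {0..T}" "(\<lambda>s. \<tau> + s) ` {0..h} \<subseteq> {0..T}" using s \<tau> by auto
      then have "(u has_vector_derivative F (u (\<tau> + s))) (at (\<tau> + s) within (\<lambda>s. \<tau> + s) ` {0..h})"
        using ode has_vector_derivative_within_subset by blast
      moreover have "((\<lambda>s. \<tau> + s) has_vector_derivative 1) (at s within {0..h})"
        by (auto intro!: derivative_eq_intros)
      ultimately have "((\<lambda>s. u (\<tau> + s)) has_vector_derivative F (u (\<tau> + s))) (at s within {0..h})"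
        using vector_diff_chain_within[of "\<lambda>s. \<tau> + s" 1 s "{0..h}" u] by (simp add: o_def)
      then show ?thesis unfolding y_def by (auto intro!: derivative_eq_intros)
    qed
    have y0: "y 0 = 0" by (simp add: y_def v_def)
    have y: "norm (y s) \<le> m * s" if "s \<in> {0..h}" for s
    proof -
      have "norm (F (u (\<tau> + s))) \<le> m * s ^ 0" if "s \<in> {0..h}" for s
        using F_le[of "\<tau> + s"] that \<tau> by auto
      from norm_le_power_Suc[OF der y0 this that] show ?thesis by simp
    qed
    have "norm (y h - h *\<^sub>R F v - (h^2/2) *\<^sub>R J (F v) - (h^3/6) *\<^sub>R (J (J (F v)) + incr2)
      - (h^4/24) *\<^sub>R (J (J (J (F v))) + J incr2 + incr3)) \<le> flow_const l m * h^5"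
      unfolding J_def
    proof (rule flow_expansion[where q = "\<lambda>s. Q (y s)"])
      fix s assume s: "s \<in> {0..h}"
      show "(y has_vector_derivative F v + blinfun_apply (fderiv F v) (y s) + Q (y s)) (at s within {0..h})"
        using der[OF s] by (simp add: Q_def J_def y_def)
      show "norm (Q (y s) - cubic (y s)) \<le> m * norm (y s) ^ 4"
      proof (rule Q)
        have "m * s \<le> m * h" using s m_nonneg by (intro mult_left_mono) auto
        then show "norm (y s) < \<delta>" using y[OF s] h by linarith
      qed
    qed (use h y y0 in auto)
    then show ?thesis by (simp add: y_def)
  qed

  define s where "s = (3/4) * h"
  define y where "y = s *\<^sub>R op_phi 1 (s *\<^sub>R J) (F v)"
  have s: "0 < s" "s \<le> 1" "s \<le> h" using h by (auto simp: s_def)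
  have Jl: "norm J \<le> l" by (simp add: J_def J)
  have hJ: "norm (h *\<^sub>R J) \<le> l * h" and sJ: "norm (s *\<^sub>R J) \<le> l * h"
  proof -
    show "norm (h *\<^sub>R J) \<le> l * h" using Jl h by (simp add: mult.commute)
    have "s * norm J \<le> h * l" using s Jl h by (intro mult_mono) auto
    then show "norm (s *\<^sub>R J) \<le> l * h" using s by (simp add: mult.commute)
  qed
  have y_jet: "norm (y - s *\<^sub>R F v - (s^2/2) *\<^sub>R J (F v)) \<le> K * s^3"
    unfolding y_def K_def
    by (rule stage_two_jet[OF \<phi>2[OF sJ] Jl f]) (use s K in auto)
  have "norm y < \<delta>"
  proof -
    have "norm y \<le> (m + l * m + K) * s"
      by (rule two_jet_bound(1)) (use s y_jet in \<open>auto simp: J_def\<close>)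
    also have "\<dots> \<le> (m + l * m + K) * h"
      using s K0 l_nonneg m_nonneg by (intro mult_left_mono) auto
    finally show ?thesis using stage by (simp add: K_def)
  qed
  then have D: "norm (Q y - (s^2/2) *\<^sub>R incr2 - (s^3/6) *\<^sub>R incr3) \<le> jet_const l m K * s^4"
    by (intro increment_of_two_jet[OF _ _ _ Q]) (use s y_jet in \<open>auto simp: J_def\<close>)
  have C0: "0 \<le> jet_const l m K"
    using l_nonneg m_nonneg K0 by (simp add: jet_const_def Let_def)
  have correction: "norm (h *\<^sub>R b2 (h *\<^sub>R J) (Q y) - (h^3/6) *\<^sub>R incr2 - (h^4/24) *\<^sub>R (J incr2 + incr3))
      \<le> correction_const l m Kb (jet_const l m K) * h^5"
    unfolding correction_const_def J_def
    by (rule correction_expansion[OF D b2[OF hJ, unfolded J_def]]) (use h s_def C0 K in auto)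
  have Euler: "norm (h *\<^sub>R op_phi 1 (h *\<^sub>R J) (F v) - h *\<^sub>R F v - (h^2/2) *\<^sub>R J (F v)
      - (h^3/6) *\<^sub>R J (J (F v)) - (h^4/24) *\<^sub>R J (J (J (F v)))) \<le> K4 * l^4 * m * h^5"
    unfolding J_def
    by (rule exponential_Euler_expansion[OF \<phi>4[OF hJ, unfolded J_def]]) (use h K in auto)

  have step: "local_error F (3/4) b2 u t0 h n =
      v + h *\<^sub>R op_phi 1 (h *\<^sub>R J) (F v) + h *\<^sub>R b2 (h *\<^sub>R J) (Q y) - u (\<tau> + h)"
  proof -
    have "ros_g F v (v + y) - ros_g F v v = Q y"
      by (simp add: ros_g_def Q_def J_def blinfun.bilinear_simps)
    moreover have "ros_stage F (3/4) h v = v + y"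
      by (simp add: ros_stage_def y_def s_def J_def)
    ultimately show ?thesis
      unfolding local_error_def ros_step_def next_grid by (simp add: J_def v_def \<tau>_def)
  qed
  \<comment> \<open>All terms up to fourth order cancel between the three expansions.\<close>
  let ?x1 = "h *\<^sub>R op_phi 1 (h *\<^sub>R J) (F v) - h *\<^sub>R F v - (h^2/2) *\<^sub>R J (F v)
      - (h^3/6) *\<^sub>R J (J (F v)) - (h^4/24) *\<^sub>R J (J (J (F v)))"
    and ?x2 = "h *\<^sub>R b2 (h *\<^sub>R J) (Q y) - (h^3/6) *\<^sub>R incr2 - (h^4/24) *\<^sub>R (J incr2 + incr3)"
    and ?x3 = "u (\<tau> + h) - v - h *\<^sub>R F v - (h^2/2) *\<^sub>R J (F v) - (h^3/6) *\<^sub>R (J (J (F v)) + incr2)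
      - (h^4/24) *\<^sub>R (J (J (J (F v))) + J incr2 + incr3)"
  have "local_error F (3/4) b2 u t0 h n = ?x1 + ?x2 - ?x3"
    unfolding step by (simp add: algebra_simps)
  then have "norm (local_error F (3/4) b2 u t0 h n) \<le> norm ?x1 + norm ?x2 + norm ?x3"
    using norm_triangle_ineq4[of "?x1 + ?x2" ?x3] norm_triangle_ineq[of ?x1 ?x2] by simp
  also have "\<dots> \<le> K4 * l^4 * m * h^5 + correction_const l m Kb (jet_const l m K) * h^5 + flow_const l m * h^5"
    by (intro add_mono Euler correction exact)
  finally show ?thesis by (simp add: K_def algebra_simps)
qed

theorem lemma3p1:
  fixes c2 :: real
    and \<beta> :: "nat \<Rightarrow> real"
    and b2 :: "('a::banach \<Rightarrow>\<^sub>L 'a) \<Rightarrow> ('a \<Rightarrow>\<^sub>L 'a)"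
  assumes "has_op_expansion b2 \<beta>"
  shows "(order_conditions c2 \<beta> \<longleftrightarrow> c2 = 3/4 \<and> \<beta> 0 = 16/27 \<and> \<beta> 1 = 4/27) \<and>
    (order_conditions c2 \<beta> \<longrightarrow>
      (\<forall>M. \<forall>\<delta>>0. \<forall>L. \<exists>C. \<exists>h0>0.
        \<forall>(F::'a \<Rightarrow> 'a) u t0 u0 T.
          solves_ivp F t0 u0 T u \<and> smooth_solution M T u \<and> smooth_field M (strip u T \<delta>) F \<longrightarrow>
          (\<forall>n h. 0 < h \<and> h \<le> h0 \<and> grid t0 h (Suc n) \<le> T \<and>
                 norm (fderiv F (u (grid t0 h n))) \<le> L \<longrightarrow>
            norm (local_error F c2 b2 u t0 h n) \<le> C * h ^ 5)))"
proof (intro conjI impI order_conditions_iff allI)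
  assume "order_conditions c2 \<beta>"
  then have coeffs: "c2 = 3/4" "\<beta> 0 = 16/27" "\<beta> 1 = 4/27" by (simp_all add: order_conditions_iff)
  fix M \<delta> L :: real
  assume \<delta>: "0 < \<delta>"
  obtain Kb \<rho>b where Kb: "0 \<le> Kb" "0 < \<rho>b"
    and b2: "\<And>A. norm A \<le> \<rho>b \<Longrightarrow> norm (b2 A - (\<Sum>k<2. \<beta> k *\<^sub>R op_power A k)) \<le> Kb * norm A ^ 2"
    using op_expansion_remainder[OF assms] by blast
  obtain K2 \<rho>2 where K2: "0 \<le> K2" "0 < \<rho>2"
    and \<phi>2: "\<And>A :: 'a \<Rightarrow>\<^sub>L 'a. norm A \<le> \<rho>2 \<Longrightarrow>
      norm (op_phi 1 A - (\<Sum>k<2. (1 / fact (Suc k)) *\<^sub>R op_power A k)) \<le> K2 * norm A ^ 2"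
    using op_expansion_remainder[OF op_phi_1_expansion] by blast
  obtain K4 \<rho>4 where K4: "0 \<le> K4" "0 < \<rho>4"
    and \<phi>4: "\<And>A :: 'a \<Rightarrow>\<^sub>L 'a. norm A \<le> \<rho>4 \<Longrightarrow>
      norm (op_phi 1 A - (\<Sum>k<4. (1 / fact (Suc k)) *\<^sub>R op_power A k)) \<le> K4 * norm A ^ 4"
    using op_expansion_remainder[OF op_phi_1_expansion] by blast
  have compose_id: "A o\<^sub>L id_blinfun = A" for A :: "'a \<Rightarrow>\<^sub>L 'a" by (auto intro: blinfun_eqI)
  \<comment> \<open>Enlarging the bounds makes them positive, so that the divisions below are legitimate.\<close>
  define m where "m = \<bar>M\<bar> + 1"
  define l where "l = \<bar>L\<bar> + 1"
  define Y where "Y = m + l * m + K2 * l^2 * m"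
  have m: "M \<le> m" "0 < m" and l: "L \<le> l" "0 < l" by (auto simp: m_def l_def)
  have Y: "m \<le> Y" "0 < Y" using m l K2 by (auto simp: Y_def intro!: add_pos_nonneg)
  \<comment> \<open>The number \<open>Y * h\<close> bounds the distance of the stage from the starting value, and \<open>l * h\<close> the norm of
    the operators at which the power series are evaluated.\<close>
  define h0 where "h0 = Min {1, 1 / m, \<delta> / (2 * Y), \<rho>b / l, \<rho>2 / l, \<rho>4 / l}"
  define C where "C = K4 * l^4 * m + correction_const l m Kb (jet_const l m (K2 * l^2 * m)) + flow_const l m"
  show "\<exists>C. \<exists>h0>0. \<forall>(F::'a \<Rightarrow> 'a) u t0 u0 T.
          solves_ivp F t0 u0 T u \<and> smooth_solution M T u \<and> smooth_field M (strip u T \<delta>) F \<longrightarrow>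
          (\<forall>n h. 0 < h \<and> h \<le> h0 \<and> grid t0 h (Suc n) \<le> T \<and>
                 norm (fderiv F (u (grid t0 h n))) \<le> L \<longrightarrow>
            norm (local_error F c2 b2 u t0 h n) \<le> C * h ^ 5)"
  proof (rule exI[of _ C], rule exI[of _ h0], intro conjI allI impI; (elim conjE)?)
    show "0 < h0" using \<delta> m l Y Kb K2 K4 by (simp add: h0_def)
  next
    fix F :: "'a \<Rightarrow> 'a" and u t0 u0 T n h
    assume ivp: "solves_ivp F t0 u0 T u" "smooth_solution M T u" "smooth_field M (strip u T \<delta>) F"
      and h: "0 < h" "h \<le> h0" and grid: "grid t0 h (Suc n) \<le> T"
      and L: "norm (fderiv F (u (grid t0 h n))) \<le> L"
    have "h \<le> 1" "h \<le> 1 / m" "h \<le> \<delta> / (2 * Y)" "h \<le> \<rho>b / l" "h \<le> \<rho>2 / l" "h \<le> \<rho>4 / l"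
      using h(2) by (auto simp: h0_def)
    then have h': "h \<le> 1" "m * h \<le> 1" "l * h \<le> \<rho>b" "l * h \<le> \<rho>2" "l * h \<le> \<rho>4" "2 * (Y * h) \<le> \<delta>"
      using m l Y by (auto simp: field_simps)
    have Yh: "Y * h < \<delta>" using h' \<delta> by linarith
    have mh: "m * h < \<delta>" using Yh mult_right_mono[OF Y(1), of h] h by linarith
    show "norm (local_error F c2 b2 u t0 h n) \<le> C * h ^ 5"
      unfolding coeffs(1) C_def
    proof (rule local_error_bound[OF ivp \<delta> m(1) order_trans[OF L l(1)] h(1) h'(1) h'(2) mh grid])
      fix A :: "'a \<Rightarrow>\<^sub>L 'a"
      assume A: "norm A \<le> l * h"
      show "norm (op_phi 1 A - id_blinfun - (1/2) *\<^sub>R A) \<le> K2 * norm A ^ 2"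
        using \<phi>2[of A] A h' by (simp add: eval_nat_numeral compose_id diff_diff_eq)
      show "norm (b2 A - (16/27) *\<^sub>R id_blinfun - (4/27) *\<^sub>R A) \<le> Kb * norm A ^ 2"
        using b2[of A] A h'
        by (simp add: eval_nat_numeral compose_id diff_diff_eq coeffs(2) coeffs(3)[unfolded One_nat_def])
      show "norm (op_phi 1 A - id_blinfun - (1/2) *\<^sub>R A - (1/6) *\<^sub>R (A o\<^sub>L A) - (1/24) *\<^sub>R (A o\<^sub>L (A o\<^sub>L A)))
        \<le> K4 * norm A ^ 4"
        using \<phi>4[of A] A h' by (simp add: eval_nat_numeral compose_id diff_diff_eq)
    qed (use K2 K4 Kb Yh in \<open>auto simp: Y_def\<close>)
  qed
qed

end
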